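(* Let $M$ be an $\mathbb{O}$-bimodule and define $\mathrm{Re}:M\to M$ by $$\mathrm{Re}\,x:=\frac{5}{12}x-\frac{1}{12}\sum_{i=1}^7 e_ixe_i.$$ Then for all $x\in M$ the following hold: 1. $\mathrm{Re}^2x=\mathrm{Re}\,x$. 2. $x=\mathrm{Re}\,x-\sum_{i=1}^7 e_i\,\mathrm{Re}(e_ix)$. 3. $\mathrm{Re}\,M=\mathscr{Z}(M)=\mathscr{A}(M)$, where $\mathrm{Re}\,M$ is the image of $\mathrm{Re}$, $\mathscr{Z}(M)=\{x\in M\mid px=xp\ \forall p\in\mathbb{O}\}$ and $\mathscr{A}(M)=\{x\in M\mid [p,q,x]=0\ \forall p,q\in\mathbb{O}\}$. 4. For all $x\in\mathrm{Re}\,M$ and $p\in\mathbb{O}$, $\mathrm{Re}(px)=(\mathrm{Re}\,p)x$, where $\mathrm{Re}\,p\in\mathbb{R}$ is the usual real part of the octonion $p$. 5. $M=\mathrm{Re}\,M\oplus\bigoplus_{i=1}^7e_i\,\mathrm{Re}\,M$.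
   Context: $\mathbb{O}$ is the real division algebra of octonions with its standard real basis $1,e_1,\ldots,e_7$, where $e_1,\dots,e_7$ are imaginary units satisfying $e_ie_j+e_je_i=-2\delta_{ij}$ and multiplied according to the Fano plane. A left $\mathbb{O}$-module is a real vector space $M$ with an $\mathbb{R}$-bilinear map $\mathbb{O}\times M\to M$, $(p,m)\mapsto pm$, such that $1m=m$ and $[p,q,m]=-[q,p,m]$ for all $p,q\in\mathbb{O}$, $m\in M$, where $[p,q,m]:=(pq)m-p(qm)$. An $\mathbb{O}$-bimodule is a left $\mathbb{O}$-module $M$ with in addition an $\mathbb{R}$-bilinear right multiplication $M\times\mathbb{O}\to M$, $(m,p)\mapsto mp$, with $m1=m$, such that $[p,q,m]=[m,p,q]=[q,m,p]$ for all $p,q\in\mathbb{O}$, $m\in M$, where $[m,p,q]:=(mp)q-m(pq)$ and $[q,m,p]:=(qm)p-q(mp)$. In a bimodule $(e_ix)e_i=e_i(xe_i)$, and this element is written $e_ixe_i$. *)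

theory Defs
  imports "HOL-Analysis.Analysis"
begin

section \<open>The octonions\<close>

datatype octonion = Octonion
  (oct_re: real)
  (oct_im1: real)
  (oct_im2: real)
  (oct_im3: real)
  (oct_im4: real)
  (oct_im5: real)
  (oct_im6: real)
  (oct_im7: real)

lemma octonion_eq_iff:
  "p = q \<longleftrightarrow> oct_re p = oct_re q \<and>
    oct_im1 p = oct_im1 q \<and>
    oct_im2 p = oct_im2 q \<and>
    oct_im3 p = oct_im3 q \<and>
    oct_im4 p = oct_im4 q \<and>
    oct_im5 p = oct_im5 q \<and>
    oct_im6 p = oct_im6 q \<and>
    oct_im7 p = oct_im7 q"
  by (cases p; cases q) auto

instantiation octonion :: real_vector
begin

definition "0 = Octonion 0 0 0 0 0 0 0 0"

definition "p + q = Octonion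
    (oct_re p + oct_re q)
    (oct_im1 p + oct_im1 q)
    (oct_im2 p + oct_im2 q)
    (oct_im3 p + oct_im3 q)
    (oct_im4 p + oct_im4 q)
    (oct_im5 p + oct_im5 q)
    (oct_im6 p + oct_im6 q)
    (oct_im7 p + oct_im7 q)"

definition "- p = Octonion
    (- oct_re p)
    (- oct_im1 p)
    (- oct_im2 p)
    (- oct_im3 p)
    (- oct_im4 p)
    (- oct_im5 p)
    (- oct_im6 p)
    (- oct_im7 p)"

definition "p - q = Octonion
    (oct_re p - oct_re q)
    (oct_im1 p - oct_im1 q)
    (oct_im2 p - oct_im2 q)
    (oct_im3 p - oct_im3 q)
    (oct_im4 p - oct_im4 q)
    (oct_im5 p - oct_im5 q)
    (oct_im6 p - oct_im6 q)
    (oct_im7 p - oct_im7 q)"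

definition "r *\<^sub>R p = Octonion
    (r * oct_re p)
    (r * oct_im1 p)
    (r * oct_im2 p)
    (r * oct_im3 p)
    (r * oct_im4 p)
    (r * oct_im5 p)
    (r * oct_im6 p)
    (r * oct_im7 p)"

instance
  by standard
    (simp_all add: octonion_eq_iff zero_octonion_def plus_octonion_def uminus_octonion_def
      minus_octonion_def scaleR_octonion_def algebra_simps)

end

text \<open>
  The multiplication is determined by the oriented lines
  (1,2,3), (1,4,5), (1,7,6), (2,4,6), (2,5,7), (3,4,7), (3,6,5) of the Fano plane: if (i,j,k) is a
  cyclic rotation of one of them, then e_i e_j = e_k = - e_j e_i.
\<close>

instantiation octonion :: "{one, times}"
begin

definition "1 = Octonion 1 0 0 0 0 0 0 0"

definition "p * q = Octonion
    (oct_re p * oct_re q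
        - oct_im1 p * oct_im1 q
        - oct_im2 p * oct_im2 q
        - oct_im3 p * oct_im3 q
        - oct_im4 p * oct_im4 q
        - oct_im5 p * oct_im5 q
        - oct_im6 p * oct_im6 q
        - oct_im7 p * oct_im7 q)
    (oct_re p * oct_im1 q + oct_im1 p * oct_re q
        + oct_im2 p * oct_im3 q - oct_im3 p * oct_im2 q
        + oct_im4 p * oct_im5 q - oct_im5 p * oct_im4 q
        + oct_im7 p * oct_im6 q - oct_im6 p * oct_im7 q)
    (oct_re p * oct_im2 q + oct_im2 p * oct_re q
        + oct_im3 p * oct_im1 q - oct_im1 p * oct_im3 q
        + oct_im4 p * oct_im6 q - oct_im6 p * oct_im4 q
        + oct_im5 p * oct_im7 q - oct_im7 p * oct_im5 q)
    (oct_re p * oct_im3 q + oct_im3 p * oct_re q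
        + oct_im1 p * oct_im2 q - oct_im2 p * oct_im1 q
        + oct_im4 p * oct_im7 q - oct_im7 p * oct_im4 q
        + oct_im6 p * oct_im5 q - oct_im5 p * oct_im6 q)
    (oct_re p * oct_im4 q + oct_im4 p * oct_re q
        + oct_im5 p * oct_im1 q - oct_im1 p * oct_im5 q
        + oct_im6 p * oct_im2 q - oct_im2 p * oct_im6 q
        + oct_im7 p * oct_im3 q - oct_im3 p * oct_im7 q)
    (oct_re p * oct_im5 q + oct_im5 p * oct_re q
        + oct_im1 p * oct_im4 q - oct_im4 p * oct_im1 q
        + oct_im7 p * oct_im2 q - oct_im2 p * oct_im7 q
        + oct_im3 p * oct_im6 q - oct_im6 p * oct_im3 q)
    (oct_re p * oct_im6 q + oct_im6 p * oct_re q
        + oct_im1 p * oct_im7 q - oct_im7 p * oct_im1 q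
        + oct_im2 p * oct_im4 q - oct_im4 p * oct_im2 q
        + oct_im5 p * oct_im3 q - oct_im3 p * oct_im5 q)
    (oct_re p * oct_im7 q + oct_im7 p * oct_re q
        + oct_im6 p * oct_im1 q - oct_im1 p * oct_im6 q
        + oct_im2 p * oct_im5 q - oct_im5 p * oct_im2 q
        + oct_im3 p * oct_im4 q - oct_im4 p * oct_im3 q)"

instance ..

end

text \<open>The imaginary units are \<open>oct_e 1\<close>, ..., \<open>oct_e 7\<close>; at all other indices \<open>oct_e\<close> is 0.\<close>

definition oct_e :: "nat \<Rightarrow> octonion" where
  "oct_e i = Octonion 0
    (of_bool (i = 1))
    (of_bool (i = 2))
    (of_bool (i = 3))
    (of_bool (i = 4))
    (of_bool (i = 5))
    (of_bool (i = 6))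
    (of_bool (i = 7))"

lemma octonion_sel_zero [simp]:
  "oct_re 0 = 0"
  "oct_im1 0 = 0"
  "oct_im2 0 = 0"
  "oct_im3 0 = 0"
  "oct_im4 0 = 0"
  "oct_im5 0 = 0"
  "oct_im6 0 = 0"
  "oct_im7 0 = 0"
  by (simp_all add: zero_octonion_def)

lemma octonion_sel_one [simp]:
  "oct_re 1 = 1"
  "oct_im1 1 = 0"
  "oct_im2 1 = 0"
  "oct_im3 1 = 0"
  "oct_im4 1 = 0"
  "oct_im5 1 = 0"
  "oct_im6 1 = 0"
  "oct_im7 1 = 0"
  by (simp_all add: one_octonion_def)

lemma octonion_sel_add [simp]:
  "oct_re (p + q) = oct_re p + oct_re q"
  "oct_im1 (p + q) = oct_im1 p + oct_im1 q"
  "oct_im2 (p + q) = oct_im2 p + oct_im2 q"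
  "oct_im3 (p + q) = oct_im3 p + oct_im3 q"
  "oct_im4 (p + q) = oct_im4 p + oct_im4 q"
  "oct_im5 (p + q) = oct_im5 p + oct_im5 q"
  "oct_im6 (p + q) = oct_im6 p + oct_im6 q"
  "oct_im7 (p + q) = oct_im7 p + oct_im7 q"
  by (simp_all add: plus_octonion_def)

lemma octonion_sel_uminus [simp]:
  "oct_re (- p) = - oct_re p"
  "oct_im1 (- p) = - oct_im1 p"
  "oct_im2 (- p) = - oct_im2 p"
  "oct_im3 (- p) = - oct_im3 p"
  "oct_im4 (- p) = - oct_im4 p"
  "oct_im5 (- p) = - oct_im5 p"
  "oct_im6 (- p) = - oct_im6 p"
  "oct_im7 (- p) = - oct_im7 p"
  by (simp_all add: uminus_octonion_def)

lemma octonion_sel_diff [simp]: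
  "oct_re (p - q) = oct_re p - oct_re q"
  "oct_im1 (p - q) = oct_im1 p - oct_im1 q"
  "oct_im2 (p - q) = oct_im2 p - oct_im2 q"
  "oct_im3 (p - q) = oct_im3 p - oct_im3 q"
  "oct_im4 (p - q) = oct_im4 p - oct_im4 q"
  "oct_im5 (p - q) = oct_im5 p - oct_im5 q"
  "oct_im6 (p - q) = oct_im6 p - oct_im6 q"
  "oct_im7 (p - q) = oct_im7 p - oct_im7 q"
  by (simp_all add: minus_octonion_def)

lemma octonion_sel_scaleR [simp]:
  "oct_re (r *\<^sub>R p) = r * oct_re p"
  "oct_im1 (r *\<^sub>R p) = r * oct_im1 p"
  "oct_im2 (r *\<^sub>R p) = r * oct_im2 p"
  "oct_im3 (r *\<^sub>R p) = r * oct_im3 p"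
  "oct_im4 (r *\<^sub>R p) = r * oct_im4 p"
  "oct_im5 (r *\<^sub>R p) = r * oct_im5 p"
  "oct_im6 (r *\<^sub>R p) = r * oct_im6 p"
  "oct_im7 (r *\<^sub>R p) = r * oct_im7 p"
  by (simp_all add: scaleR_octonion_def)

lemma octonion_sel_mult [simp]:
  "oct_re (p * q) = oct_re p * oct_re q
        - oct_im1 p * oct_im1 q
        - oct_im2 p * oct_im2 q
        - oct_im3 p * oct_im3 q
        - oct_im4 p * oct_im4 q
        - oct_im5 p * oct_im5 q
        - oct_im6 p * oct_im6 q
        - oct_im7 p * oct_im7 q"
  "oct_im1 (p * q) = oct_re p * oct_im1 q + oct_im1 p * oct_re q
        + oct_im2 p * oct_im3 q - oct_im3 p * oct_im2 q
        + oct_im4 p * oct_im5 q - oct_im5 p * oct_im4 q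
        + oct_im7 p * oct_im6 q - oct_im6 p * oct_im7 q"
  "oct_im2 (p * q) = oct_re p * oct_im2 q + oct_im2 p * oct_re q
        + oct_im3 p * oct_im1 q - oct_im1 p * oct_im3 q
        + oct_im4 p * oct_im6 q - oct_im6 p * oct_im4 q
        + oct_im5 p * oct_im7 q - oct_im7 p * oct_im5 q"
  "oct_im3 (p * q) = oct_re p * oct_im3 q + oct_im3 p * oct_re q
        + oct_im1 p * oct_im2 q - oct_im2 p * oct_im1 q
        + oct_im4 p * oct_im7 q - oct_im7 p * oct_im4 q
        + oct_im6 p * oct_im5 q - oct_im5 p * oct_im6 q"
  "oct_im4 (p * q) = oct_re p * oct_im4 q + oct_im4 p * oct_re q
        + oct_im5 p * oct_im1 q - oct_im1 p * oct_im5 q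
        + oct_im6 p * oct_im2 q - oct_im2 p * oct_im6 q
        + oct_im7 p * oct_im3 q - oct_im3 p * oct_im7 q"
  "oct_im5 (p * q) = oct_re p * oct_im5 q + oct_im5 p * oct_re q
        + oct_im1 p * oct_im4 q - oct_im4 p * oct_im1 q
        + oct_im7 p * oct_im2 q - oct_im2 p * oct_im7 q
        + oct_im3 p * oct_im6 q - oct_im6 p * oct_im3 q"
  "oct_im6 (p * q) = oct_re p * oct_im6 q + oct_im6 p * oct_re q
        + oct_im1 p * oct_im7 q - oct_im7 p * oct_im1 q
        + oct_im2 p * oct_im4 q - oct_im4 p * oct_im2 q
        + oct_im5 p * oct_im3 q - oct_im3 p * oct_im5 q"
  "oct_im7 (p * q) = oct_re p * oct_im7 q + oct_im7 p * oct_re q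
        + oct_im6 p * oct_im1 q - oct_im1 p * oct_im6 q
        + oct_im2 p * oct_im5 q - oct_im5 p * oct_im2 q
        + oct_im3 p * oct_im4 q - oct_im4 p * oct_im3 q"
  by (simp_all add: times_octonion_def)

lemma octonion_sel_e [simp]:
  "oct_re (oct_e j) = 0"
  "oct_im1 (oct_e j) = of_bool (j = 1)"
  "oct_im2 (oct_e j) = of_bool (j = 2)"
  "oct_im3 (oct_e j) = of_bool (j = 3)"
  "oct_im4 (oct_e j) = of_bool (j = 4)"
  "oct_im5 (oct_e j) = of_bool (j = 5)"
  "oct_im6 (oct_e j) = of_bool (j = 6)"
  "oct_im7 (oct_e j) = of_bool (j = 7)"
  by (simp_all add: oct_e_def)

lemma octonion_mult_one: "1 * p = p" "p * 1 = p" for p :: octonion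
  by (simp_all add: octonion_eq_iff)

lemma octonion_basis_expansion:
  "p = oct_re p *\<^sub>R 1 + oct_im1 p *\<^sub>R oct_e 1
    + oct_im2 p *\<^sub>R oct_e 2
    + oct_im3 p *\<^sub>R oct_e 3
    + oct_im4 p *\<^sub>R oct_e 4
    + oct_im5 p *\<^sub>R oct_e 5
    + oct_im6 p *\<^sub>R oct_e 6
    + oct_im7 p *\<^sub>R oct_e 7"
  by (simp add: octonion_eq_iff)

lemma bilinear_octonion_mult: "bilinear ((*) :: octonion \<Rightarrow> octonion \<Rightarrow> octonion)"
  unfolding bilinear_def
  by (intro conjI allI linearI; simp add: octonion_eq_iff; simp add: algebra_simps)

lemma oct_e_anticommute:
  assumes "i \<in> {1..7}" "j \<in> {1..7}"
  shows "oct_e i * oct_e j + oct_e j * oct_e i = (- 2 * of_bool (i = j)) *\<^sub>R 1"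
proof -
  have *: "{1..7::nat} = {1, 2, 3, 4, 5, 6, 7}"
    by (simp add: atLeastAtMost_upt upt_rec numeral_eq_Suc)
  have "\<forall>i\<in>{1..7}. \<forall>j\<in>{1..7}.
      oct_e i * oct_e j + oct_e j * oct_e i = (- 2 * of_bool (i = j)) *\<^sub>R 1"
    unfolding * by (simp add: octonion_eq_iff)
  with assms show ?thesis by blast
qed

lemma oct_e_Fano:
  "\<forall>(i, j, k) \<in> {(1, 2, 3), (1, 4, 5), (1, 7, 6), (2, 4, 6), (2, 5, 7), (3, 4, 7), (3, 6, 5)}.
    oct_e i * oct_e j = oct_e k \<and> oct_e j * oct_e k = oct_e i \<and> oct_e k * oct_e i = oct_e j"
  by (simp add: octonion_eq_iff)

lemma octonion_alternative: "(p * p) * q = p * (p * q)" "(p * q) * q = p * (q * q)" for p q :: octonion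
  unfolding octonion_eq_iff octonion_sel_mult by (intro conjI; algebra)+

definition oct_normsq :: "octonion \<Rightarrow> real" where
  "oct_normsq p = (oct_re p)\<^sup>2 + (oct_im1 p)\<^sup>2 + (oct_im2 p)\<^sup>2 + (oct_im3 p)\<^sup>2
    + (oct_im4 p)\<^sup>2 + (oct_im5 p)\<^sup>2 + (oct_im6 p)\<^sup>2 + (oct_im7 p)\<^sup>2"

lemma oct_normsq_mult: "oct_normsq (p * q) = oct_normsq p * oct_normsq q"
  unfolding oct_normsq_def octonion_sel_mult by algebra


section \<open>Octonionic modules and bimodules\<close>

definition left_assoc ::
    "(octonion \<Rightarrow> 'm \<Rightarrow> 'm) \<Rightarrow> octonion \<Rightarrow> octonion \<Rightarrow> 'm \<Rightarrow> 'm::real_vector" where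
  "left_assoc lm p q m = lm (p * q) m - lm p (lm q m)"

definition right_assoc ::
    "('m \<Rightarrow> octonion \<Rightarrow> 'm) \<Rightarrow> 'm \<Rightarrow> octonion \<Rightarrow> octonion \<Rightarrow> 'm::real_vector" where
  "right_assoc rm m p q = rm (rm m p) q - rm m (p * q)"

definition mid_assoc ::
    "(octonion \<Rightarrow> 'm \<Rightarrow> 'm) \<Rightarrow> ('m \<Rightarrow> octonion \<Rightarrow> 'm) \<Rightarrow> octonion \<Rightarrow> 'm \<Rightarrow> octonion \<Rightarrow> 'm::real_vector" where
  "mid_assoc lm rm q m p = rm (lm q m) p - lm q (rm m p)"

locale octonion_left_module =
  fixes lm :: "octonion \<Rightarrow> 'm \<Rightarrow> 'm::real_vector"
  assumes left_bilinear: "bilinear lm"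
    and left_one: "lm 1 m = m"
    and left_alternative: "left_assoc lm p q m = - left_assoc lm q p m"

locale octonion_bimodule = octonion_left_module lm
  for lm :: "octonion \<Rightarrow> 'm \<Rightarrow> 'm::real_vector" +
  fixes rm :: "'m \<Rightarrow> octonion \<Rightarrow> 'm"
  assumes right_bilinear: "bilinear rm"
    and right_one: "rm m 1 = m"
    and assoc_left_right: "left_assoc lm p q m = right_assoc rm m p q"
    and assoc_right_mid: "right_assoc rm m p q = mid_assoc lm rm q m p"

lemma octonion_bimodule_self: "octonion_bimodule (*) (*)"
  apply unfold_locales
       apply (simp_all only: bilinear_octonion_mult octonion_mult_one)
    apply (simp_all only: left_assoc_def right_assoc_def mid_assoc_def octonion_eq_iff
      octonion_sel_diff octonion_sel_uminus octonion_sel_mult)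
    apply (intro conjI; algebra)+
  done

text \<open>The element $e_i x e_i$ is bracketed as $(e_i x) e_i$.\<close>

definition bimod_Re ::
    "(octonion \<Rightarrow> 'm \<Rightarrow> 'm) \<Rightarrow> ('m \<Rightarrow> octonion \<Rightarrow> 'm) \<Rightarrow> 'm \<Rightarrow> 'm::real_vector" where
  "bimod_Re lm rm x =
    (5 / 12) *\<^sub>R x - (1 / 12) *\<^sub>R (\<Sum>i = 1..7. rm (lm (oct_e i) x) (oct_e i))"

definition bimod_center ::
    "(octonion \<Rightarrow> 'm \<Rightarrow> 'm) \<Rightarrow> ('m \<Rightarrow> octonion \<Rightarrow> 'm) \<Rightarrow> 'm::real_vector set" where
  "bimod_center lm rm = {x. \<forall>p. lm p x = rm x p}"

definition bimod_nucleus :: "(octonion \<Rightarrow> 'm \<Rightarrow> 'm) \<Rightarrow> 'm::real_vector set" where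
  "bimod_nucleus lm = {x. \<forall>p q. left_assoc lm p q x = 0}"

text \<open>
  The whole space is the internal direct sum of the family of subspaces \<open>V\<close> indexed by \<open>I\<close>;
  \<open>I\<close> is meant to be finite.
\<close>

definition internal_direct_sum :: "'i set \<Rightarrow> ('i \<Rightarrow> 'm::real_vector set) \<Rightarrow> bool" where
  "internal_direct_sum I V \<longleftrightarrow>
    (\<forall>i\<in>I. subspace (V i)) \<and> (\<forall>x. \<exists>!f. f \<in> (\<Pi>\<^sub>E i\<in>I. V i) \<and> x = (\<Sum>i\<in>I. f i))"

end

theory Submission
  imports Defs
begin

text \<open>
  Write $L_i$ and $R_i$ for the left and right multiplications by $e_i$. The $L_i$ satisfy the
  Clifford relations. The cyclic symmetry of $(q,r,x)p - (q,r,px)$ in $p,q,r$, a consequence of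
  alternativity, expresses $R_{[p,q,r]}$ through left multiplications; since every $e_j$ is half an
  associator, $2 R_j = \sum L_i L_k - L_j$, the sum running over the cyclically oriented lines
  $(j,i,k)$. Hence $8\,\mathrm{Re} = 1 - \sum_l W_l$ with $W_l = L_i L_j L_k$ over the seven lines
  $l = (i,j,k)$. The decomposition of part 2 then already holds for every Clifford module, while
  $R_7^2 = -1$ forces $L_1 \cdots L_7 = -1$, so that the $-W_l$ together with $1$ form an elementary
  abelian group of order 8 and Re is the projection onto its fixed points. These are exactly the
  central elements, and for central $x$ the map $p \mapsto px$ is a bimodule homomorphism.
\<close>

\<comment> \<open>Keeps the index of \<open>oct_e 1\<close> a numeral, so that rules mentioning it still match.\<close>
declare One_nat_def [simp del]

section \<open>Products of the units and vector-space arithmetic\<close>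

lemma atLeastAtMost_1_7: "{1..7::nat} = {1, 2, 3, 4, 5, 6, 7}"
  by (simp add: atLeastAtMost_upt upt_rec numeral_eq_Suc)

lemma sum_1_7: "sum f {1..7::nat} = f 1 + f 2 + f 3 + f 4 + f 5 + f 6 + f 7"
  for f :: "nat \<Rightarrow> 'a::comm_monoid_add"
  unfolding atLeastAtMost_1_7 by (simp add: add.assoc)

lemma oct_e_square: "i \<in> {1..7} \<Longrightarrow> oct_e i * oct_e i = - 1"
  by (auto simp add: atLeastAtMost_1_7 octonion_eq_iff)

abbreviation Fano_lines :: "(nat \<times> nat \<times> nat) set" where
  "Fano_lines \<equiv> {(1, 2, 3), (1, 4, 5), (1, 7, 6), (2, 4, 6), (2, 5, 7), (3, 4, 7), (3, 6, 5)}"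

lemma oct_e_Fano_neg:
  "\<forall>(i, j, k) \<in> Fano_lines.
    oct_e j * oct_e i = - oct_e k \<and> oct_e k * oct_e j = - oct_e i \<and> oct_e i * oct_e k = - oct_e j"
  by (simp add: octonion_eq_iff)

lemmas oct_e_mult = oct_e_Fano[simplified ball_simps ball_empty split_conv simp_thms conj_assoc]
  oct_e_Fano_neg[simplified ball_simps ball_empty split_conv simp_thms conj_assoc]

lemma oct_mult_neg: "p * (- q) = - (p * q)" "(- p) * q = - (p * q)" for p q :: octonion
  by (simp_all add: octonion_eq_iff)

lemma real_vector_eq_neg_self: "x = - x \<longleftrightarrow> x = 0" for x :: "'a::real_vector"
  by (metis add.right_inverse neg_equal_0_iff_equal scaleR_2 scaleR_eq_0_iff zero_neq_numeral)

text \<open>With integer multiples written as repeated sums, words in the \<open>E i\<close> can be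
  compared by additive cancellation.\<close>

lemma scaleR_numeral_unfold:
  "numeral (num.Bit0 n) *\<^sub>R x = numeral n *\<^sub>R x + numeral n *\<^sub>R x"
  "numeral (num.Bit1 n) *\<^sub>R x = numeral n *\<^sub>R x + numeral n *\<^sub>R x + x"
  "numeral num.One *\<^sub>R x = x"
  for x :: "'a::real_vector"
  by (simp_all only: numeral.simps scaleR_add_left scaleR_one)

section \<open>Clifford relations of the left multiplications\<close>

context octonion_left_module
begin

lemmas lm_simps [simp] =
  bilinear_ladd[OF left_bilinear] bilinear_radd[OF left_bilinear]
  bilinear_lsub[OF left_bilinear] bilinear_rsub[OF left_bilinear]
  bilinear_lneg[OF left_bilinear] bilinear_rneg[OF left_bilinear]
  bilinear_lmul[OF left_bilinear] bilinear_rmul[OF left_bilinear]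
  bilinear_lzero[OF left_bilinear] bilinear_rzero[OF left_bilinear] left_one

lemma linear_lm: "linear (lm p)"
  using left_bilinear by (simp add: bilinear_def)

lemma lm_anticommutator: "lm p (lm q x) + lm q (lm p x) = lm (p * q + q * p) x"
  using left_alternative[of p q x] by (simp add: left_assoc_def algebra_simps)

abbreviation E :: "nat \<Rightarrow> 'm \<Rightarrow> 'm" where
  "E i \<equiv> lm (oct_e i)"

text \<open>The condition \<open>j < i\<close> orients this as a rewrite rule: with
  \<open>E_square\<close> it sorts words in \<open>E 1\<close>, ..., \<open>E 7\<close> into signed
  words with strictly increasing indices.\<close>

lemma E_swap: "E i (E j x) = - E j (E i x)" if "j < i"
proof -
  have "oct_e i * oct_e j + oct_e j * oct_e i = 0"
    using that by (simp add: octonion_eq_iff of_bool_def)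
  then show ?thesis
    using lm_anticommutator[of "oct_e i" "oct_e j" x] by (simp add: eq_neg_iff_add_eq_0 del: lm_simps(1))
qed

lemma E_square: "E i (E i x) = - x" if "i \<in> {1..7}"
proof -
  have "oct_e i * oct_e i + oct_e i * oct_e i = (-2) *\<^sub>R 1"
    using oct_e_anticommute[OF that that] by simp
  then have "2 *\<^sub>R E i (E i x) = 2 *\<^sub>R (- x)"
    using lm_anticommutator[of "oct_e i" "oct_e i" x]
    by (simp only: scaleR_2 lm_simps) (simp add: scaleR_2)
  then show ?thesis by (simp del: scaleR_minus_right)
qed

lemmas clifford = E_swap E_square

end

section \<open>Right multiplication expressed through left multiplication\<close>

context octonion_bimodule
begin

lemmas rm_simps [simp] =
  bilinear_ladd[OF right_bilinear] bilinear_radd[OF right_bilinear]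
  bilinear_lsub[OF right_bilinear] bilinear_rsub[OF right_bilinear]
  bilinear_lneg[OF right_bilinear] bilinear_rneg[OF right_bilinear]
  bilinear_lmul[OF right_bilinear] bilinear_rmul[OF right_bilinear]
  bilinear_lzero[OF right_bilinear] bilinear_rzero[OF right_bilinear] right_one

abbreviation A where "A \<equiv> left_assoc lm"

lemma lm_mult: "lm (p * q) x = lm p (lm q x) + A p q x"
  by (simp add: left_assoc_def)

lemma rm_mult: "rm x (p * q) = rm (rm x p) q - A p q x"
  by (simp add: assoc_left_right right_assoc_def)

lemma rm_lm: "rm (lm q x) p = lm q (rm x p) + A p q x"
  by (simp add: assoc_left_right assoc_right_mid mid_assoc_def)

text \<open>With the associator in its middle form, the product \<open>q * r\<close> acts only from
  the left, where \<open>lm_mult\<close> expands it.\<close>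

lemma assoc_mult_right:
  "A p (q * r) x = A p q (lm r x) + lm q (A p r x) + rm (A q r x) p - A q r (rm x p)"
proof -
  have "A p (q * r) x = rm (lm (q * r) x) p - lm (q * r) (rm x p)"
    by (simp add: rm_lm)
  also have "\<dots> = A p q (lm r x) + lm q (A p r x) + rm (A q r x) p - A q r (rm x p)"
    by (simp add: lm_mult rm_lm)
  finally show ?thesis .
qed

text \<open>Here the middle form lets the product act only from the right, where
  \<open>rm_mult\<close> expands it.\<close>

lemma assoc_mult_left:
  "A (q * r) p x = A r p (rm x q) + rm (A q p x) r - A q r (lm p x) + lm p (A q r x)"
proof -
  have "A (q * r) p x = rm (lm p x) (q * r) - lm p (rm x (q * r))"
    by (simp add: rm_lm)
  also have "\<dots> = A r p (rm x q) + rm (A q p x) r - A q r (lm p x) + lm p (A q r x)"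
    by (simp add: rm_mult rm_lm)
  finally show ?thesis .
qed

lemma rm_assoc_cyclic:
  "rm (A q r x) p - A q r (lm p x) = rm (A p q x) r - A p q (lm r x)"
proof -
  define H where "H p q r = rm (A q r x) p - A q r (lm p x)" for p q r
  define H' where "H' p q r = lm p (A q r x) - A q r (rm x p)" for p q r
  have A_neg: "A v u y = - A u v y" for u v y
    by (rule left_alternative)
  have H_neg: "H p r q = - H p q r" "H' p r q = - H' p q r" for p q r
    using A_neg[of q r] by (simp_all add: H_def H'_def)
  \<comment> \<open>Skew-symmetry of \<open>A p (q * r)\<close> relates the differences of \<open>H\<close> and \<open>H'\<close> under cyclic shifts;
    the same with \<open>q\<close> and \<open>r\<close> exchanged gives enough relations to make both shift-invariant.\<close>
  have *: "H p q r - H r p q = H' q r p - H' p q r" for p q r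
  proof -
    have "0 = A p (q * r) x + A (q * r) p x"
      using A_neg[of "q * r" p x] by simp
    also have "\<dots> = (H p q r - H r p q) - (H' q r p - H' p q r)"
      using A_neg[of q p x] A_neg[of p r]
      by (simp add: assoc_mult_right assoc_mult_left H_def H'_def algebra_simps)
    finally show ?thesis by simp
  qed
  have **: "H p q r - H q r p = H' r p q - H' p q r" for p q r
    using *[of p r q] H_neg[of p q r] H_neg[of q r p] H_neg[of r p q] by (simp add: algebra_simps)
  \<comment> \<open>Up to sign, \<open>*\<close> and \<open>**\<close> evaluate the same difference
    of \<open>H\<close>; equating the two values eliminates \<open>H\<close>.\<close>
  have 1: "H' q r p - H' p q r = H' r p q - H' q r p"
    using *[of p q r] **[of r p q] by (metis minus_diff_eq)
  have 2: "H' r p q - H' p q r = H' q r p - H' r p q"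
    using **[of p q r] *[of q r p] by (metis minus_diff_eq)
  define u where "u = H' q r p - H' p q r"
  have "u + u + u = (H' r p q - H' p q r) + (H' r p q - H' q r p)"
    unfolding u_def by (subst (2 3) 1) simp
  also have "\<dots> = 0"
    unfolding 2 by simp
  finally have "3 *\<^sub>R u = 0"
    by (simp add: scaleR_numeral_unfold)
  then have "H p q r = H r p q"
    using *[of p q r] by (simp add: u_def)
  then show ?thesis by (simp add: H_def)
qed

text \<open>In the expansion, \<open>assoc_mult_right\<close> cancels \<open>A q r (rm x p)\<close>,
  and the cyclic symmetry trades the remaining right multiplications for
  \<open>A q r (lm p x)\<close>.\<close>

lemma rm_associator:
  "rm x ((p * q) * r - p * (q * r)) =
    lm (q * r) (lm p x) + lm (p * q) (lm r x) - lm q (lm (r * p) x) - lm ((p * q) * r) x"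
proof -
  have "rm x ((p * q) * r - p * (q * r)) =
      A q r (rm x p) - rm (A p q x) r + A p (q * r) x - A (p * q) r x"
    by (simp add: rm_mult)
  also have "\<dots> = A q r (lm p x) + lm q (A p r x) - A (p * q) r x"
    using rm_assoc_cyclic[of q r x p] by (simp add: assoc_mult_right algebra_simps)
  also have "A p r x = - A r p x"
    by (rule left_alternative)
  finally show ?thesis
    by (simp add: left_assoc_def)
qed

lemma rm_E:
  "2 *\<^sub>R rm x (oct_e 1) = E 2 (E 3 x) + E 4 (E 5 x) + E 7 (E 6 x) - E 1 x"
  "2 *\<^sub>R rm x (oct_e 2) = E 3 (E 1 x) + E 4 (E 6 x) + E 5 (E 7 x) - E 2 x"
  "2 *\<^sub>R rm x (oct_e 3) = E 1 (E 2 x) + E 4 (E 7 x) + E 6 (E 5 x) - E 3 x"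
  "2 *\<^sub>R rm x (oct_e 4) = E 5 (E 1 x) + E 6 (E 2 x) + E 7 (E 3 x) - E 4 x"
  "2 *\<^sub>R rm x (oct_e 5) = E 1 (E 4 x) + E 7 (E 2 x) + E 3 (E 6 x) - E 5 x"
  "2 *\<^sub>R rm x (oct_e 6) = E 1 (E 7 x) + E 2 (E 4 x) + E 5 (E 3 x) - E 6 x"
  "2 *\<^sub>R rm x (oct_e 7) = E 6 (E 1 x) + E 2 (E 5 x) + E 3 (E 4 x) - E 7 x"
  \<comment> \<open>Each triple is not collinear in the Fano plane and is ordered so that its
    associator is 2 times the unit of the corresponding equation.\<close>
  using rm_associator[of x "oct_e 4" "oct_e 6" "oct_e 3"]
    rm_associator[of x "oct_e 4" "oct_e 7" "oct_e 1"]
    rm_associator[of x "oct_e 4" "oct_e 5" "oct_e 2"]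
    rm_associator[of x "oct_e 7" "oct_e 2" "oct_e 1"]
    rm_associator[of x "oct_e 2" "oct_e 3" "oct_e 4"]
    rm_associator[of x "oct_e 2" "oct_e 3" "oct_e 7"]
    rm_associator[of x "oct_e 1" "oct_e 2" "oct_e 4"]
  by (simp_all only: oct_e_mult lm_simps rm_simps oct_mult_neg)
     (simp_all add: scaleR_2 clifford algebra_simps)

lemma rm_square: "rm (rm x (oct_e i)) (oct_e i) = - x" if "i \<in> {1..7}"
proof -
  have "A (oct_e i) (oct_e i) x = 0"
    using left_alternative[of "oct_e i" "oct_e i" x] by (simp add: real_vector_eq_neg_self)
  moreover have "oct_e i * oct_e i = - 1"
    using oct_e_square that by simp
  ultimately show ?thesis
    using rm_mult[of x "oct_e i" "oct_e i"] by simp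
qed

lemma volume: "E 1 (E 2 (E 3 (E 4 (E 5 (E 6 (E 7 x)))))) = - x"
proof -
  \<comment> \<open>Let $W_1, W_2, W_3$ be the words of the three lines through 7. They are commuting involutions
    whose product is the volume element, and $N$ is $-2$ times the sum of their first two elementary
    symmetric functions.\<close>
  define N where "N y = 2 *\<^sub>R rm (2 *\<^sub>R rm y (oct_e 7)) (oct_e 7) + 4 *\<^sub>R y" for y
  have N_0: "N y = 0" for y
    by (simp add: N_def rm_square)
  \<comment> \<open>With s1, s2 those symmetric functions, s1 (s1 + s2) = 3 + 2 (s1 + s2) + 3 W_1
    W_2 W_3, hence (2 - s1) N = 6 (1 + W_1 W_2 W_3).\<close>
  have "6 *\<^sub>R (E 1 (E 2 (E 3 (E 4 (E 5 (E 6 (E 7 x)))))) + x) =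
      2 *\<^sub>R N x - N (E 6 (E 1 (E 7 x))) - N (E 2 (E 5 (E 7 x))) - N (E 3 (E 4 (E 7 x)))"
    unfolding N_def rm_E by (simp add: clifford algebra_simps scaleR_numeral_unfold)
  then show ?thesis
    by (simp add: N_0 eq_neg_iff_add_eq_0)
qed

text \<open>Applying a four-letter word to \<open>volume\<close> cancels its letters and leaves the
  word of the complementary line.\<close>

lemma four_words:
  "E 4 (E 5 (E 6 (E 7 x))) = - E 1 (E 2 (E 3 x))"
  "E 2 (E 3 (E 6 (E 7 x))) = - E 1 (E 4 (E 5 x))"
  "E 2 (E 3 (E 4 (E 5 x))) = - E 1 (E 6 (E 7 x))"
  "E 1 (E 3 (E 5 (E 7 x))) = - E 2 (E 4 (E 6 x))"
  "E 1 (E 3 (E 4 (E 6 x))) = - E 2 (E 5 (E 7 x))"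
  "E 1 (E 2 (E 5 (E 6 x))) = - E 3 (E 4 (E 7 x))"
  "E 1 (E 2 (E 4 (E 7 x))) = - E 3 (E 5 (E 6 x))"
  using arg_cong[OF volume, of "\<lambda>y. E 4 (E 5 (E 6 (E 7 y)))" x]
    arg_cong[OF volume, of "\<lambda>y. E 2 (E 3 (E 6 (E 7 y)))" x]
    arg_cong[OF volume, of "\<lambda>y. E 2 (E 3 (E 4 (E 5 y)))" x]
    arg_cong[OF volume, of "\<lambda>y. E 1 (E 3 (E 5 (E 7 y)))" x]
    arg_cong[OF volume, of "\<lambda>y. E 1 (E 3 (E 4 (E 6 y)))" x]
    arg_cong[OF volume, of "\<lambda>y. E 1 (E 2 (E 5 (E 6 y)))" x]
    arg_cong[OF volume, of "\<lambda>y. E 1 (E 2 (E 4 (E 7 y)))" x]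
  by (simp_all add: clifford)

section \<open>Re in terms of the words of the lines\<close>

lemma bimod_Re_clifford:
  "bimod_Re lm rm x = (1 / 8) *\<^sub>R (x - E 1 (E 2 (E 3 x)) - E 1 (E 4 (E 5 x)) + E 1 (E 6 (E 7 x))
     - E 2 (E 4 (E 6 x)) - E 2 (E 5 (E 7 x)) - E 3 (E 4 (E 7 x)) + E 3 (E 5 (E 6 x)))"
proof -
  \<comment> \<open>By \<open>rm_E\<close>, twice the i-th summand is x plus the words of the lines
    through i. Each line has three points, so what remains is (10 - 7) x minus 3 times all line
    words.\<close>
  have "24 *\<^sub>R bimod_Re lm rm x =
    10 *\<^sub>R x - (2 *\<^sub>R rm (E 1 x) (oct_e 1) + 2 *\<^sub>R rm (E 2 x) (oct_e 2) + 2 *\<^sub>R rm (E 3 x) (oct_e 3)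
     + 2 *\<^sub>R rm (E 4 x) (oct_e 4) + 2 *\<^sub>R rm (E 5 x) (oct_e 5) + 2 *\<^sub>R rm (E 6 x) (oct_e 6)
     + 2 *\<^sub>R rm (E 7 x) (oct_e 7))"
    unfolding bimod_Re_def sum_1_7 by (simp add: algebra_simps)
  also have "\<dots> = 24 *\<^sub>R ((1 / 8) *\<^sub>R (x - E 1 (E 2 (E 3 x)) - E 1 (E 4 (E 5 x)) + E 1 (E 6 (E 7 x))
     - E 2 (E 4 (E 6 x)) - E 2 (E 5 (E 7 x)) - E 3 (E 4 (E 7 x)) + E 3 (E 5 (E 6 x))))"
    unfolding rm_E by (simp add: clifford algebra_simps scaleR_numeral_unfold)
  finally show ?thesis
    by (rule scaleR_left_imp_eq [rotated]) simp
qed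

text \<open>The word of a line commutes with its own three units and anticommutes with the other
  four. In 8 times the right side the line words thus cancel as 1 + 3 - 4 = 0, while x occurs 1 + 7
  times.\<close>

lemma bimod_Re_decomposition:
  "x = bimod_Re lm rm x - (\<Sum>i = 1..7. E i (bimod_Re lm rm (E i x)))"
proof -
  have "8 *\<^sub>R x = 8 *\<^sub>R (bimod_Re lm rm x - (\<Sum>i = 1..7. E i (bimod_Re lm rm (E i x))))"
    unfolding bimod_Re_clifford sum_1_7
    by (simp add: clifford algebra_simps) (simp add: scaleR_numeral_unfold algebra_simps)
  then show ?thesis by simp
qed

lemma bimod_Re_line:
  assumes "(i, j, k) \<in> Fano_lines"
  shows "E i (E j (E k (bimod_Re lm rm x))) = - bimod_Re lm rm x"
proof -
  let ?y = "8 *\<^sub>R bimod_Re lm rm x"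
  have y: "?y = x - E 1 (E 2 (E 3 x)) - E 1 (E 4 (E 5 x)) + E 1 (E 6 (E 7 x))
     - E 2 (E 4 (E 6 x)) - E 2 (E 5 (E 7 x)) - E 3 (E 4 (E 7 x)) + E 3 (E 5 (E 6 x))"
    by (simp add: bimod_Re_clifford)
  \<comment> \<open>Minus the word of a line permutes the eight signed terms of \<open>?y\<close>;
    \<open>four_words\<close> turns products of two different line words back into line
    words.\<close>
  have "E i (E j (E k ?y)) = - ?y"
    using assms unfolding y by (auto simp: clifford four_words)
  then show ?thesis
    by (simp flip: scaleR_minus_right)
qed

text \<open>The second conclusion is the hypothesis for the rotated triple, so repeated use runs
  around the whole line.\<close>

lemma line_rotate:
  assumes "E i (E j (E k x)) = - x" "i \<noteq> j" "i \<noteq> k" "i \<in> {1..7}"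
  shows "E j (E k x) = E i x" "E j (E k (E i x)) = - x"
proof -
  show 1: "E j (E k x) = E i x"
    using arg_cong[OF assms(1), of "E i"] assms(4) by (simp add: clifford)
  have swap: "E a (E b y) = - E b (E a y)" if "a \<noteq> b" for a b y
    using E_swap[of a b y] E_swap[of b a y] that by (metis minus_minus nat_neq_iff)
  show "E j (E k (E i x)) = - x"
    using assms(1) swap[of i j "E k x"] swap[of i k x] assms(2,3) by simp
qed

section \<open>Center, nucleus and image of Re\<close>

lemma center_if_lines:
  assumes lines: "\<forall>(i, j, k) \<in> Fano_lines. E i (E j (E k x)) = - x"
  shows "x \<in> bimod_center lm rm"
proof -
  have "E i (E j x) = E k x \<and> E j (E k x) = E i x \<and> E k (E i x) = E j x"
    if ijk: "(i, j, k) \<in> Fano_lines" for i j k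
  proof -
    from ijk have d: "i \<noteq> j" "i \<noteq> k" "j \<noteq> k" "i \<in> {1..7}" "j \<in> {1..7}" "k \<in> {1..7}"
      by auto
    have 1: "E i (E j (E k x)) = - x"
      using lines ijk by blast
    note 2 = line_rotate[OF 1 d(1,2,4)]
    note 3 = line_rotate[OF 2(2) d(3) d(1)[symmetric] d(5)]
    note 4 = line_rotate[OF 3(2) d(2)[symmetric] d(3)[symmetric] d(6)]
    show ?thesis
      using 2 3 4 by simp
  qed
  then have pairs:
    "E 2 (E 3 x) = E 1 x" "E 4 (E 5 x) = E 1 x" "E 7 (E 6 x) = E 1 x"
    "E 3 (E 1 x) = E 2 x" "E 4 (E 6 x) = E 2 x" "E 5 (E 7 x) = E 2 x"
    "E 1 (E 2 x) = E 3 x" "E 4 (E 7 x) = E 3 x" "E 6 (E 5 x) = E 3 x"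
    "E 5 (E 1 x) = E 4 x" "E 6 (E 2 x) = E 4 x" "E 7 (E 3 x) = E 4 x"
    "E 1 (E 4 x) = E 5 x" "E 7 (E 2 x) = E 5 x" "E 3 (E 6 x) = E 5 x"
    "E 1 (E 7 x) = E 6 x" "E 2 (E 4 x) = E 6 x" "E 5 (E 3 x) = E 6 x"
    "E 6 (E 1 x) = E 7 x" "E 2 (E 5 x) = E 7 x" "E 3 (E 4 x) = E 7 x"
    by simp_all
  \<comment> \<open>Each of the three lines through i contributes one \<open>E i x\<close> to
    \<open>rm_E\<close>.\<close>
  have rm_eq: "rm x (oct_e i) = E i x" if "2 *\<^sub>R rm x (oct_e i) = E i x + E i x + E i x - E i x" for i
    using that by (simp flip: scaleR_2)
  have "rm x (oct_e 1) = E 1 x" "rm x (oct_e 2) = E 2 x" "rm x (oct_e 3) = E 3 x" "rm x (oct_e 4) = E 4 x"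
    "rm x (oct_e 5) = E 5 x" "rm x (oct_e 6) = E 6 x" "rm x (oct_e 7) = E 7 x"
    by (rule rm_eq, simp only: rm_E pairs)+
  then have "lm p x = rm x p" for p
    by (subst (1 2) octonion_basis_expansion[of p]) (simp only: lm_simps rm_simps)
  then show ?thesis
    by (simp add: bimod_center_def)
qed

text \<open>For commuting \<open>x\<close> the right form of the associator is -2 times the left
  form, so 3 times the associator vanishes.\<close>

lemma center_subset_nucleus: "bimod_center lm rm \<subseteq> bimod_nucleus lm"
proof
  fix x assume "x \<in> bimod_center lm rm"
  then have comm: "rm x p = lm p x" for p
    by (simp add: bimod_center_def)
  have "A p q x = 0" for p q
  proof -
    have "A p q x = rm (lm p x) q - lm (p * q) x"
      by (simp add: assoc_left_right right_assoc_def comm)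
    also have "\<dots> = lm p (lm q x) + A q p x - lm (p * q) x"
      by (simp add: rm_lm comm)
    also have "\<dots> = - A p q x - A p q x"
      using left_alternative[of q p x] by (simp add: left_assoc_def)
    finally have "3 *\<^sub>R A p q x = 0"
      by (simp add: scaleR_numeral_unfold algebra_simps)
    then show ?thesis by simp
  qed
  then show "x \<in> bimod_nucleus lm"
    by (simp add: bimod_nucleus_def)
qed

text \<open>On the nucleus the word of a line acts as the octonion e_i (e_j e_k) = -1.\<close>

lemma nucleus_eq_center: "bimod_nucleus lm = bimod_center lm rm"
proof (intro equalityI subsetI)
  fix x assume "x \<in> bimod_nucleus lm"
  then have assoc: "lm p (lm q x) = lm (p * q) x" for p q
    by (simp add: bimod_nucleus_def left_assoc_def)
  show "x \<in> bimod_center lm rm"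
    by (rule center_if_lines) (auto simp add: assoc oct_e_mult oct_e_square oct_mult_neg)
qed (use center_subset_nucleus in blast)

lemma bimod_Re_lm:
  assumes "x \<in> bimod_center lm rm"
  shows "bimod_Re lm rm (lm p x) = oct_re p *\<^sub>R x"
proof -
  have assoc: "A p q x = 0" for p q
    using assms center_subset_nucleus by (auto simp: bimod_nucleus_def)
  have lm2: "lm p (lm q x) = lm (p * q) x" for p q
    using assoc[of p q] by (simp add: left_assoc_def)
  have rm2: "rm (lm p x) q = lm (p * q) x" for p q
    using assms by (simp add: rm_lm assoc lm2 flip: lm2) (simp add: bimod_center_def)
  have "bimod_Re lm rm (lm p x) = lm (bimod_Re (*) (*) p) x"
    by (simp add: bimod_Re_def lm2 rm2 sum_1_7)
  also have "bimod_Re (*) (*) p = oct_re p *\<^sub>R 1"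
    unfolding bimod_Re_def sum_1_7 by (simp add: octonion_eq_iff)
  finally show ?thesis by simp
qed

lemma bimod_Re_center:
  assumes "x \<in> bimod_center lm rm"
  shows "bimod_Re lm rm x = x"
  using bimod_Re_lm[OF assms, of 1] by simp

lemma range_bimod_Re: "range (bimod_Re lm rm) = bimod_center lm rm"
proof (intro equalityI subsetI)
  fix y assume "y \<in> range (bimod_Re lm rm)"
  then obtain x where "y = bimod_Re lm rm x" by blast
  then show "y \<in> bimod_center lm rm"
    using bimod_Re_line by (intro center_if_lines) blast
next
  fix y assume "y \<in> bimod_center lm rm"
  then show "y \<in> range (bimod_Re lm rm)"
    using bimod_Re_center by (metis rangeI)
qed

section \<open>The direct sum\<close>

lemma linear_bimod_Re: "linear (bimod_Re lm rm)"
  unfolding bimod_Re_def sum_1_7 by (intro linearI) (simp_all add: algebra_simps)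

text \<open>Reads the components off \<open>x\<close>, which gives uniqueness in the direct sum; the
  sign of \<open>a j\<close> is that of the square of \<open>oct_e j\<close>.\<close>

lemma bimod_Re_coordinates:
  assumes a: "\<And>i. i \<in> {0..7} \<Longrightarrow> a i \<in> bimod_center lm rm"
    and x: "x = a 0 + (\<Sum>i = 1..7. E i (a i))"
  shows "bimod_Re lm rm x = a 0" "j \<in> {1..7} \<Longrightarrow> bimod_Re lm rm (E j x) = - a j"
proof -
  have E: "bimod_Re lm rm (E i (a k)) = 0" if "k \<in> {0..7}" for i k
    using bimod_Re_lm[OF a[OF that]] by simp
  show "bimod_Re lm rm x = a 0"
    unfolding x by (simp add: linear_add[OF linear_bimod_Re] linear_sum[OF linear_bimod_Re] E bimod_Re_center a)
  assume j: "j \<in> {1..7}"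
  have "bimod_Re lm rm (E j (E i (a i))) = (if i = j then - a j else 0)" if "i \<in> {1..7}" for i
  proof -
    have ai: "a i \<in> bimod_center lm rm"
      using a that by simp
    have "E j (E i (a i)) = lm (oct_e j * oct_e i) (a i)"
      using ai center_subset_nucleus by (auto simp: bimod_nucleus_def left_assoc_def)
    moreover have "oct_re (oct_e j * oct_e i) = - of_bool (i = j)"
      using that j by (auto simp: of_bool_def atLeastAtMost_1_7)
    ultimately show ?thesis
      by (simp add: bimod_Re_lm[OF ai])
  qed
  then show "bimod_Re lm rm (E j x) = - a j"
    unfolding x using j
    by (simp add: linear_add[OF linear_bimod_Re] linear_sum[OF linear_bimod_Re] E linear_sum[OF linear_lm])
qed

lemma bimod_Re_direct_sum:
  "internal_direct_sum {0..7::nat}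
     (\<lambda>i. if i = 0 then range (bimod_Re lm rm) else E i ` range (bimod_Re lm rm))"
    (is "internal_direct_sum _ ?V")
  unfolding internal_direct_sum_def
proof (intro conjI ballI allI)
  have range: "subspace (range (bimod_Re lm rm))"
    using linear_subspace_image[OF linear_bimod_Re] subspace_UNIV by blast
  show "subspace (?V i)" for i
    using range by (auto intro!: linear_subspace_image linear_lm)
  fix x
  have split: "(\<Sum>i\<in>{0..7}. f i) = f 0 + (\<Sum>i = 1..7. f i)" for f :: "nat \<Rightarrow> 'm"
    by (simp add: sum.atLeast_Suc_atMost One_nat_def)
  show "\<exists>!f. f \<in> (\<Pi>\<^sub>E i\<in>{0..7}. ?V i) \<and> x = (\<Sum>i\<in>{0..7}. f i)"
  proof (rule ex1I)
    \<comment> \<open>The components come from \<open>bimod_Re_decomposition\<close>; the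
      restriction makes the function \<open>undefined\<close> outside the index set, as the
      extensional product requires.\<close>
    let ?f = "\<lambda>i\<in>{0..7}. if i = 0 then bimod_Re lm rm x else - E i (bimod_Re lm rm (E i x))"
    have "- E i (bimod_Re lm rm y) \<in> E i ` range (bimod_Re lm rm)" for i y
    proof (intro image_eqI)
      show "- E i (bimod_Re lm rm y) = E i (bimod_Re lm rm (- y))"
        by (simp add: linear_neg[OF linear_bimod_Re])
    qed simp_all
    then have "?f \<in> (\<Pi>\<^sub>E i\<in>{0..7}. ?V i)"
      by auto
    moreover have "(\<Sum>i\<in>{0..7}. ?f i) = x"
      using bimod_Re_decomposition[of x] unfolding split by (simp add: sum_1_7 algebra_simps)
    ultimately show "?f \<in> (\<Pi>\<^sub>E i\<in>{0..7}. ?V i) \<and> x = (\<Sum>i\<in>{0..7}. ?f i)"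
      by simp
    fix f assume f: "f \<in> (\<Pi>\<^sub>E i\<in>{0..7}. ?V i) \<and> x = (\<Sum>i\<in>{0..7}. f i)"
    have "\<forall>i\<in>{0..7}. \<exists>c. c \<in> bimod_center lm rm \<and> f i = (if i = 0 then c else E i c)"
    proof
      fix i :: nat
      assume "i \<in> {0..7}"
      then have "f i \<in> ?V i"
        by (rule PiE_mem [OF conjunct1 [OF f]])
      then show "\<exists>c. c \<in> bimod_center lm rm \<and> f i = (if i = 0 then c else E i c)"
        unfolding range_bimod_Re by (cases "i = 0") auto
    qed
    from bchoice[OF this] obtain a where
      "\<forall>i\<in>{0..7}. a i \<in> bimod_center lm rm \<and> f i = (if i = 0 then a i else E i (a i))" ..
    then have a: "\<And>i. i \<in> {0..7} \<Longrightarrow> a i \<in> bimod_center lm rm"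
      and fa: "\<And>i. i \<in> {0..7} \<Longrightarrow> f i = (if i = 0 then a i else E i (a i))"
      by simp_all
    have "x = f 0 + (\<Sum>i = 1..7. f i)"
      using conjunct2 [OF f] unfolding split .
    also have "\<dots> = a 0 + (\<Sum>i = 1..7. E i (a i))"
      by (simp add: fa)
    finally have x: "x = a 0 + (\<Sum>i = 1..7. E i (a i))" .
    show "f = ?f"
    proof
      fix i
      show "f i = ?f i"
      proof (cases "i \<in> {0..7}")
        case True
        then show ?thesis
          using bimod_Re_coordinates(1) [OF a x] bimod_Re_coordinates(2) [OF a x, of i]
          by (simp add: fa)
      next
        case False
        then show ?thesis
          using PiE_arb [OF conjunct1 [OF f]] by simp
      qed
    qed
  qed
qed

end

theorem theorem4p4:
  fixes lm :: "octonion \<Rightarrow> 'm \<Rightarrow> 'm::real_vector"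
    and rm :: "'m \<Rightarrow> octonion \<Rightarrow> 'm"
  assumes "octonion_bimodule lm rm"
  shows "(\<forall>x. bimod_Re lm rm (bimod_Re lm rm x) = bimod_Re lm rm x)
    \<and> (\<forall>x. x = bimod_Re lm rm x - (\<Sum>i = 1..7. lm (oct_e i) (bimod_Re lm rm (lm (oct_e i) x))))
    \<and> range (bimod_Re lm rm) = bimod_center lm rm
    \<and> bimod_center lm rm = bimod_nucleus lm
    \<and> (\<forall>x \<in> range (bimod_Re lm rm). \<forall>p. bimod_Re lm rm (lm p x) = oct_re p *\<^sub>R x)
    \<and> internal_direct_sum {0..7::nat}
        (\<lambda>i. if i = 0 then range (bimod_Re lm rm)
             else lm (oct_e i) ` range (bimod_Re lm rm))"
proof -
  interpret octonion_bimodule lm rm by fact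
  show ?thesis
    using bimod_Re_center bimod_Re_lm range_bimod_Re nucleus_eq_center bimod_Re_decomposition bimod_Re_direct_sum
    by blast
qed

end
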